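(* Let $A\in\mathbb{R}^{n\times n}$ be invertible and consider GMRES(1) applied to $Ax=b$, where $A$ is symmetric or $M=I-A$ is skew-symmetric. Then the residuals converge q-linearly with q-factor $\sigma$: $$\|r_k\|\le\sigma\,\|r_{k-1}\|,$$ where: (i) if $A$ is symmetric, $\sigma=\max_{i\ne j}\frac{|a_j-a_i|}{|a_j|+|a_i|}=\left|\frac{\lambda_{\max}(A)-\lambda_{\min}(A)}{\lambda_{\max}(A)+\lambda_{\min}(A)}\right|$ when $A$ is definite, and $\sigma=1$ when $A$ is indefinite; (ii) if $M=I-A$ is skew-symmetric ($n$ even), $\sigma=\frac{m^*}{\sqrt{1+(m^* )^2}}$.
   Context: $\langle\cdot,\cdot\rangle$ and $\|\cdot\|$ are the Euclidean inner product and norm. For $v\neq 0$ put $\alpha(v)=\frac{\langle v,Av\rangle}{\langle Av,Av\rangle}$. GMRES(1) (minimal residual iteration) for $Ax=b$: given $x_0\in\mathbb{R}^n$, set $r_0=Ax_0-b$ and, for $k=0,1,2,\dots$ until convergence, $x_{k+1}=x_k-\alpha(r_k)r_k$ and $r_{k+1}=r_k-\alpha(r_k)Ar_k$. A sequence $\{y_k\}$ converges q-linearly with q-factor $\sigma\in(0,1)$ to $y^*$ if $\|y_k-y^*\|\le\sigma\|y_{k-1}-y^*\|$ for $k\ge1$; for the residuals, $y^*=0$. For symmetric $A$, $a_1,\dots,a_p$ are its distinct eigenvalues and $\lambda_{\max}(A),\lambda_{\min}(A)$ are the largest and smallest ones. "Definite" means positive definite or negative definite; "indefinite" means having both positive and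 negative eigenvalues. $m^*$ is the largest modulus of an eigenvalue of $M$. *)

theory Defs
  imports "HOL-Analysis.Analysis"
begin

definition gmres_alpha :: "real^'n^'n \<Rightarrow> real^'n \<Rightarrow> real" where
  "gmres_alpha A v = (v \<bullet> (A *v v)) / ((A *v v) \<bullet> (A *v v))"

text \<open>The pair of iterate and residual after \<open>k\<close> steps. The residual is \<open>A x - b\<close>, not
  \<open>b - A x\<close>. The iteration stops on reaching a zero residual; the sequences are then
  continued as constant.\<close>
primrec gmres1 :: "real^'n^'n \<Rightarrow> real^'n \<Rightarrow> real^'n \<Rightarrow> nat \<Rightarrow> (real^'n) \<times> (real^'n)" where
  "gmres1 A b x0 0 = (x0, A *v x0 - b)"
| "gmres1 A b x0 (Suc k) =
     (let (x, r) = gmres1 A b x0 k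
      in if r = 0 then (x, r)
         else (x - gmres_alpha A r *\<^sub>R r, r - gmres_alpha A r *\<^sub>R (A *v r)))"

definition gmres1_residual :: "real^'n^'n \<Rightarrow> real^'n \<Rightarrow> real^'n \<Rightarrow> nat \<Rightarrow> real^'n" where
  "gmres1_residual A b x0 k = snd (gmres1 A b x0 k)"

definition q_linearly_converges :: "(nat \<Rightarrow> 'a::real_normed_vector) \<Rightarrow> 'a \<Rightarrow> real \<Rightarrow> bool" where
  "q_linearly_converges y l \<sigma> \<longleftrightarrow>
     0 < \<sigma> \<and> \<sigma> < 1 \<and> (\<forall>k\<ge>1. norm (y k - l) \<le> \<sigma> * norm (y (k - 1) - l))"

definition eigenvalues :: "'a::field^'n^'n \<Rightarrow> 'a set" where
  "eigenvalues A = {c. \<exists>v. v \<noteq> 0 \<and> A *v v = c *s v}"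

definition lambda_max :: "real^'n^'n \<Rightarrow> real" where
  "lambda_max A = Max (eigenvalues A)"

definition lambda_min :: "real^'n^'n \<Rightarrow> real" where
  "lambda_min A = Min (eigenvalues A)"

definition positive_definite :: "real^'n^'n \<Rightarrow> bool" where
  "positive_definite A \<longleftrightarrow> (\<forall>v. v \<noteq> 0 \<longrightarrow> v \<bullet> (A *v v) > 0)"

definition negative_definite :: "real^'n^'n \<Rightarrow> bool" where
  "negative_definite A \<longleftrightarrow> (\<forall>v. v \<noteq> 0 \<longrightarrow> v \<bullet> (A *v v) < 0)"

definition definite :: "real^'n^'n \<Rightarrow> bool" where
  "definite A \<longleftrightarrow> positive_definite A \<or> negative_definite A"

definition indefinite :: "real^'n^'n \<Rightarrow> bool" where
  "indefinite A \<longleftrightarrow> (\<exists>a\<in>eigenvalues A. a > 0) \<and> (\<exists>a\<in>eigenvalues A. a < 0)"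

text \<open>The maximum over pairs of distinct eigenvalues. The extra element 0 only matters
  when \<open>A\<close> has a single eigenvalue: there is then no such pair, and the maximum over the
  empty family of nonnegative numbers is taken to be 0.\<close>
definition symmetric_factor :: "real^'n^'n \<Rightarrow> real" where
  "symmetric_factor A =
     Max (insert 0 {\<bar>a' - a\<bar> / (\<bar>a'\<bar> + \<bar>a\<bar>) | a a'.
                      a \<in> eigenvalues A \<and> a' \<in> eigenvalues A \<and> a \<noteq> a'})"

text \<open>The largest modulus of an eigenvalue. The eigenvalues are the complex ones: a real
  skew-symmetric matrix has no nonzero real eigenvalue.\<close>
definition max_eigenvalue_modulus :: "real^'n^'n \<Rightarrow> real" where
  "max_eigenvalue_modulus M = Max (cmod ` eigenvalues (map_matrix complex_of_real M))"

definition skew_factor :: "real^'n^'n \<Rightarrow> real" where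
  "skew_factor M = max_eigenvalue_modulus M / sqrt (1 + (max_eigenvalue_modulus M)\<^sup>2)"

end

theory Submission
  imports Defs
begin

text \<open>
  For fixed \<open>r\<close>, the scalar \<open>gmres_alpha A r\<close> minimizes \<open>t \<mapsto> \<parallel>r - t A r\<parallel>\<close>. One step of GMRES(1)
  therefore reduces the residual at least as much as the step with any other \<open>t\<close>, in particular
  one chosen from the spectrum of \<open>A\<close> independently of \<open>r\<close> (\<open>minimal_residual_step_le\<close>). What
  remains is to find a good constant \<open>t\<close> in each of the two cases.

  Symmetric \<open>A\<close>. Let \<open>l\<close> and \<open>u\<close> be the extreme eigenvalues. The Rayleigh bounds
  \<open>l \<parallel>x\<parallel>\<^sup>2 \<le> \<langle>x, A x\<rangle> \<le> u \<parallel>x\<parallel>\<^sup>2\<close> make \<open>A - l I\<close> and \<open>u I - A\<close> positive semidefinite; they commute, so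
  their product is positive semidefinite too (\<open>selfadjoint_between_scalars\<close>), that is,
  \<open>\<parallel>A r\<parallel>\<^sup>2 \<le> (l + u) \<langle>r, A r\<rangle> - l u \<parallel>r\<parallel>\<^sup>2\<close>. If \<open>l\<close> and \<open>u\<close> have the same sign, inserting this with
  \<open>t = 2 / (l + u)\<close> into \<open>\<parallel>r - t A r\<parallel>\<^sup>2\<close> leaves exactly \<open>((u - l) / (u + l))\<^sup>2 \<parallel>r\<parallel>\<^sup>2\<close>. Otherwise,
  as \<open>l = u = 0\<close> is impossible for invertible \<open>A\<close>, the factor is \<open>1\<close> and \<open>t = 0\<close> suffices. That
  the maximum over pairs of eigenvalues is attained at the extreme pair is the monotonicity of the relative gap (\<open>relative_gap_mono\<close>).

  Skew-symmetric \<open>M = I - A\<close>. Here \<open>\<langle>r, A r\<rangle> = \<parallel>r\<parallel>\<^sup>2\<close> and \<open>\<parallel>A r\<parallel>\<^sup>2 = \<parallel>r\<parallel>\<^sup>2 + \<parallel>M r\<parallel>\<^sup>2\<close>, since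
  \<open>\<langle>r, M r\<rangle> = 0\<close>. The moduli of the complex eigenvalues of \<open>M\<close> are the singular values of \<open>M\<close>
  (\<open>skew_eigenvalue_moduli\<close>), so \<open>\<parallel>M r\<parallel> \<le> m \<parallel>r\<parallel>\<close> where \<open>m\<close> is the largest modulus, and
  \<open>t = 1 / (1 + m\<^sup>2)\<close> yields \<open>\<parallel>r - t A r\<parallel>\<^sup>2 \<le> m\<^sup>2 / (1 + m\<^sup>2) \<parallel>r\<parallel>\<^sup>2\<close>. This reduces the complex
  spectral problem to the symmetric matrix \<open>M\<^sup>T M\<close>, so only the Rayleigh bounds are needed.
\<close>

section \<open>Self-adjoint operators between two scalars\<close>

text \<open>An isotropic vector \<open>v\<close> minimizes the form \<open>x \<bullet> f x\<close>, so the derivative at \<open>v\<close>, which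
  is \<open>2 *\<^sub>R f v\<close>, vanishes. Concretely, a small step from \<open>v\<close> against \<open>f v\<close> would otherwise make
  the form negative.\<close>

lemma nonneg_selfadjoint_isotropic_imp_kernel:
  fixes f :: "'a::real_inner \<Rightarrow> 'a"
  assumes "linear f" and sa: "\<And>x y. f x \<bullet> y = x \<bullet> f y"
    and nonneg: "\<And>x. 0 \<le> x \<bullet> f x" and iso: "v \<bullet> f v = 0"
  shows "f v = 0"
proof (rule ccontr)
  assume nz: "f v \<noteq> 0"
  define n where "n = f v \<bullet> f v"
  define q where "q = f v \<bullet> f (f v)"
  have n: "n > 0" using nz by (simp add: n_def)
  have q: "q \<ge> 0" by (simp add: q_def nonneg)
  have "(v - s *\<^sub>R f v) \<bullet> f (v - s *\<^sub>R f v) = s\<^sup>2 * q - 2 * s * n" for s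
    using iso sa[of v "f v"]
    by (simp add: linear_diff[OF assms(1)] linear_cmul[OF assms(1)] inner_diff_left
        inner_diff_right n_def q_def power2_eq_square algebra_simps)
  \<comment> \<open>Any \<open>s\<close> strictly between \<open>0\<close> and \<open>2 * n / q\<close> makes the right-hand side negative; the
    summand \<open>1\<close> in the denominator covers \<open>q = 0\<close>.\<close>
  moreover define s where "s = n / (q + 1)"
  ultimately have "0 \<le> s * (s * q) - 2 * s * n"
    using nonneg[of "v - s *\<^sub>R f v"] by (simp add: power2_eq_square)
  also have "s * q = n - s" using q by (simp add: s_def field_simps)
  also have "s * (n - s) - 2 * s * n = - (s * s + s * n)" by (simp add: algebra_simps)
  also have "s > 0" using n q by (simp add: s_def)
  then have "- (s * s + s * n) < 0" using n by (simp only: neg_less_0_iff_less add_pos_pos mult_pos_pos)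
  finally show False by simp
qed

text \<open>By compactness the form \<open>x \<bullet> f x\<close> has a minimum \<open>l\<close> on the unit sphere. Its minimizer is
  isotropic for the nonnegative operator \<open>f - l\<close>, hence lies in the kernel of \<open>f - l\<close>.\<close>

lemma rayleigh_minimum_is_eigenvalue:
  fixes f :: "'a::euclidean_space \<Rightarrow> 'a"
  assumes lin: "linear f" and sa: "\<And>x y. f x \<bullet> y = x \<bullet> f y"
  obtains l v where "v \<noteq> 0" "f v = l *\<^sub>R v" "\<And>x. l * (x \<bullet> x) \<le> x \<bullet> f x"
proof -
  have "compact (sphere (0::'a) 1)" by simp
  moreover have "sphere (0::'a) 1 \<noteq> {}" by (simp add: sphere_eq_empty)
  moreover have "continuous_on (sphere 0 1) (\<lambda>x. x \<bullet> f x)"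
    using lin by (intro continuous_intros linear_continuous_on linear_linear[THEN iffD2]) auto
  ultimately obtain v where v: "v \<in> sphere 0 1"
    and min: "\<And>y. y \<in> sphere 0 1 \<Longrightarrow> v \<bullet> f v \<le> y \<bullet> f y"
    using continuous_attains_inf[of "sphere (0::'a) 1" "\<lambda>x. x \<bullet> f x"] by auto
  have vv: "v \<bullet> v = 1" using v by (simp add: dot_square_norm)
  define l where "l = v \<bullet> f v"
  have bound: "l * (x \<bullet> x) \<le> x \<bullet> f x" for x
  proof (cases "x = 0")
    case False
    have "l \<le> (x /\<^sub>R norm x) \<bullet> f (x /\<^sub>R norm x)"
      unfolding l_def using False by (intro min) simp
    also have "\<dots> = (x \<bullet> f x) / (x \<bullet> x)"
      using False by (simp add: linear_cmul[OF lin] dot_square_norm power2_eq_square divide_inverse)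
    finally show ?thesis using False by (simp add: field_simps)
  qed (simp add: linear_0[OF lin])
  have "f v - l *\<^sub>R v = 0"
  proof (rule nonneg_selfadjoint_isotropic_imp_kernel[of "\<lambda>x. f x - l *\<^sub>R x"])
    show "linear (\<lambda>x. f x - l *\<^sub>R x)"
      using lin by (intro linear_compose_sub linear_compose_scale_right) (auto simp: linear_id[unfolded id_def])
  qed (use bound vv in \<open>auto simp: sa l_def inner_diff_left inner_diff_right\<close>)
  moreover have "v \<noteq> 0" using vv by auto
  ultimately show ?thesis using that[of v l] bound by simp
qed

text \<open>The inequality says that \<open>(f - l) (u - f)\<close> is nonnegative. With \<open>p = f - l\<close> and
  \<open>c = u - l\<close>, both \<open>p\<close> and \<open>c - p\<close> are nonnegative, and the identity
  \<open>c p (c - p) = p (c - p) p + (c - p) p (c - p)\<close> exhibits \<open>c\<close> times the product as a sum of two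
  nonnegative operators; this avoids a square root or a simultaneous diagonalization.\<close>

lemma selfadjoint_between_scalars:
  fixes f :: "'a::real_inner \<Rightarrow> 'a"
  assumes lin: "linear f" and sa: "\<And>x y. f x \<bullet> y = x \<bullet> f y"
    and lower: "\<And>x. l * (x \<bullet> x) \<le> x \<bullet> f x" and upper: "\<And>x. x \<bullet> f x \<le> u * (x \<bullet> x)"
  shows "f x \<bullet> f x \<le> (l + u) * (x \<bullet> f x) - l * u * (x \<bullet> x)"
proof -
  define p where "p = (\<lambda>x. f x - l *\<^sub>R x)"
  define c where "c = u - l"
  have linp: "linear p" unfolding p_def
    using lin by (intro linear_compose_sub linear_compose_scale_right) (auto simp: linear_id[unfolded id_def])
  have sap: "p x \<bullet> y = x \<bullet> p y" for x y
    by (simp add: p_def sa inner_diff_left inner_diff_right)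
  have lowp: "0 \<le> y \<bullet> p y" and upp: "y \<bullet> p y \<le> c * (y \<bullet> y)" for y
    using lower[of y] upper[of y] by (auto simp: p_def c_def inner_diff_right algebra_simps)
  have "0 \<le> c * (x \<bullet> p x) - p x \<bullet> p x"
  proof (cases "c > 0")
    case True
    have "c * (c * (x \<bullet> p x) - p x \<bullet> p x) =
        (c * (p x \<bullet> p x) - p x \<bullet> p (p x)) + (c *\<^sub>R x - p x) \<bullet> p (c *\<^sub>R x - p x)"
      using sap[of x "p x"]
      by (simp add: linear_diff[OF linp] linear_cmul[OF linp] inner_diff_left inner_diff_right
          algebra_simps)
    moreover have "\<dots> \<ge> 0" using lowp[of "c *\<^sub>R x - p x"] upp[of "p x"] by simp
    ultimately have "0 \<le> c * (c * (x \<bullet> p x) - p x \<bullet> p x)" by simp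
    then show ?thesis using True by (simp only: zero_le_mult_iff) linarith
  next
    case False
    then have "c * (x \<bullet> x) \<le> 0" by (simp add: mult_nonpos_nonneg)
    \<comment> \<open>Here the identity carries no information, but the two bounds force \<open>p x = 0\<close>.\<close>
    then have 0: "x \<bullet> p x = 0" using lowp[of x] upp[of x] by linarith
    then have "p x = 0" by (intro nonneg_selfadjoint_isotropic_imp_kernel[OF linp sap lowp])
    then show ?thesis by simp
  qed
  moreover have "c * (x \<bullet> p x) - p x \<bullet> p x = (l + u) * (x \<bullet> f x) - l * u * (x \<bullet> x) - f x \<bullet> f x"
    by (simp add: p_def c_def inner_diff_left inner_diff_right inner_commute[of "f x" x] algebra_simps)
  ultimately show ?thesis by simp
qed

section \<open>Extreme eigenvalues of symmetric matrices\<close>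

lemma symmetric_inner_matrix_vector:
  fixes A :: "real^'n^'n"
  assumes "transpose A = A"
  shows "(A *v x) \<bullet> y = x \<bullet> (A *v y)"
  by (metis assms dot_lmul_matrix transpose_matrix_vector)

lemma mem_eigenvalues_real_iff:
  fixes A :: "real^'n^'n"
  shows "c \<in> eigenvalues A \<longleftrightarrow> (\<exists>v. v \<noteq> 0 \<and> A *v v = c *\<^sub>R v)"
  by (simp add: eigenvalues_def scalar_mult_eq_scaleR)

text \<open>Choosing one eigenvector for each eigenvalue gives pairwise orthogonal nonzero vectors, of
  which a Euclidean space contains only finitely many.\<close>

lemma finite_eigenvalues_symmetric:
  fixes A :: "real^'n^'n"
  assumes sym: "transpose A = A"
  shows "finite (eigenvalues A)"
proof -
  have "\<forall>c\<in>eigenvalues A. \<exists>v. v \<noteq> 0 \<and> A *v v = c *\<^sub>R v"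
    by (simp add: mem_eigenvalues_real_iff)
  then obtain w where w: "\<And>c. c \<in> eigenvalues A \<Longrightarrow> w c \<noteq> 0 \<and> A *v w c = c *\<^sub>R w c"
    by metis
  have orth: "w c \<bullet> w d = 0" if "c \<in> eigenvalues A" "d \<in> eigenvalues A" "c \<noteq> d" for c d
    using symmetric_inner_matrix_vector[OF sym, of "w c" "w d"] w[OF that(1)] w[OF that(2)] that(3)
    by simp
  have "inj_on w (eigenvalues A)"
    using orth w by (metis inj_onI inner_eq_zero_iff)
  moreover have "pairwise orthogonal (w ` eigenvalues A)"
    using orth by (auto simp: pairwise_def orthogonal_def)
  then have "finite (w ` eigenvalues A)"
    using w by (intro pairwise_orthogonal_imp_finite)
  ultimately show ?thesis by (rule finite_imageD[rotated])
qed

text \<open>Minimizing the Rayleigh quotients of \<open>A\<close> and of \<open>- A\<close> shows that eigenvalues exist and that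
  some of them satisfy the two bounds; the extreme eigenvalues then do as well. Finiteness of the
  spectrum is what makes the maximum and minimum genuine.\<close>

lemma symmetric_extreme_eigenvalues:
  fixes A :: "real^'n^'n"
  assumes sym: "transpose A = A"
  shows "lambda_min A \<in> eigenvalues A" "lambda_max A \<in> eigenvalues A"
    and "\<And>c. c \<in> eigenvalues A \<Longrightarrow> lambda_min A \<le> c \<and> c \<le> lambda_max A"
    and "lambda_min A * (x \<bullet> x) \<le> x \<bullet> (A *v x)" "x \<bullet> (A *v x) \<le> lambda_max A * (x \<bullet> x)"
proof -
  note fin = finite_eigenvalues_symmetric[OF sym] and sa = symmetric_inner_matrix_vector[OF sym]
  obtain l v where l: "v \<noteq> 0" "A *v v = l *\<^sub>R v" "\<And>x. l * (x \<bullet> x) \<le> x \<bullet> (A *v x)"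
    using rayleigh_minimum_is_eigenvalue[OF matrix_vector_mul_linear sa] by blast
  have "linear (\<lambda>x. - (A *v x))" by (intro linear_compose_neg) simp
  moreover have "- (A *v x) \<bullet> y = x \<bullet> - (A *v y)" for x y by (simp add: sa)
  ultimately obtain u w where u: "w \<noteq> 0" "- (A *v w) = u *\<^sub>R w"
    "\<And>x. u * (x \<bullet> x) \<le> x \<bullet> - (A *v x)"
    using rayleigh_minimum_is_eigenvalue[of "\<lambda>x. - (A *v x)"] by blast
  have lev: "l \<in> eigenvalues A" using l mem_eigenvalues_real_iff by blast
  have "A *v w = (- u) *\<^sub>R w" using u(2) by (metis minus_equation_iff scaleR_minus_left)
  then have uev: "- u \<in> eigenvalues A" using u(1) mem_eigenvalues_real_iff by blast
  show "lambda_min A \<in> eigenvalues A" "lambda_max A \<in> eigenvalues A"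
    using fin lev by (auto simp: lambda_min_def lambda_max_def intro: Min_in Max_in)
  show ext: "lambda_min A \<le> c \<and> c \<le> lambda_max A" if "c \<in> eigenvalues A" for c
    using that fin by (simp add: lambda_min_def lambda_max_def)
  have "lambda_min A * (x \<bullet> x) \<le> l * (x \<bullet> x)"
    using ext[OF lev] by (intro mult_right_mono) auto
  with l(3)[of x] show "lambda_min A * (x \<bullet> x) \<le> x \<bullet> (A *v x)" by linarith
  have "(- u) * (x \<bullet> x) \<le> lambda_max A * (x \<bullet> x)"
    using ext[OF uev] by (intro mult_right_mono) auto
  with u(3)[of x] show "x \<bullet> (A *v x) \<le> lambda_max A * (x \<bullet> x)" by simp
qed

section \<open>The convergence factor of a symmetric matrix\<close>

text \<open>Widening the interval \<open>[l, u]\<close> increases the relative gap of its ends: if it lies on one side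
  of \<open>0\<close>, the gap \<open>(a' - a) / (a' + a)\<close> is a monotone function of the ratio \<open>a' / a\<close>; if it
  contains \<open>0\<close>, the gap of the ends already has the largest possible value \<open>1\<close>. The degenerate
  interval \<open>{0}\<close> is consistent because division by zero gives \<open>0\<close>.\<close>

lemma relative_gap_mono:
  fixes a a' l u :: real
  assumes "l \<le> a" "a \<le> u" "l \<le> a'" "a' \<le> u"
  shows "\<bar>a' - a\<bar> / (\<bar>a'\<bar> + \<bar>a\<bar>) \<le> \<bar>u - l\<bar> / (\<bar>u\<bar> + \<bar>l\<bar>)"
proof -
  have main: "\<bar>a' - a\<bar> / (\<bar>a'\<bar> + \<bar>a\<bar>) \<le> \<bar>u - l\<bar> / (\<bar>u\<bar> + \<bar>l\<bar>)"
    if "0 < l" "l \<le> a" "a \<le> a'" "a' \<le> u" for a a' l u :: real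
  proof -
    have "l * a' \<le> a * u" using that by (intro mult_mono) auto
    then show ?thesis using that by (simp add: divide_simps) (simp add: algebra_simps)
  qed
  consider "0 < l" | "u < 0" | "l = 0" "u = 0" | "l \<le> 0" "0 \<le> u" "\<bar>u\<bar> + \<bar>l\<bar> > 0" by linarith
  then show ?thesis
  proof cases
    case 1
    then show ?thesis using main[of l a a' u] main[of l a' a u] assms
      by (cases "a \<le> a'") (auto simp: abs_minus_commute add.commute)
  next
    case 2
    then show ?thesis using main[of "-u" "-a" "-a'" "-l"] main[of "-u" "-a'" "-a" "-l"] assms
      by (cases "a \<le> a'") (auto simp: abs_minus_commute add.commute)
  next
    case 3
    then show ?thesis using assms by simp
  next
    case 4
    then have "\<bar>u - l\<bar> = \<bar>u\<bar> + \<bar>l\<bar>" by simp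
    with 4(3) have "\<bar>u - l\<bar> / (\<bar>u\<bar> + \<bar>l\<bar>) = 1" by (simp only: divide_self_if) simp
    moreover have "\<bar>a' - a\<bar> / (\<bar>a'\<bar> + \<bar>a\<bar>) \<le> 1"
      using abs_triangle_ineq4[of a' a] by (intro divide_le_eq_1[THEN iffD2]) linarith
    ultimately show ?thesis by linarith
  qed
qed

lemma symmetric_factor_eq:
  fixes A :: "real^'n^'n"
  assumes sym: "transpose A = A"
  shows "symmetric_factor A =
    \<bar>lambda_max A - lambda_min A\<bar> / (\<bar>lambda_max A\<bar> + \<bar>lambda_min A\<bar>)" (is "_ = ?s")
proof -
  note ext = symmetric_extreme_eigenvalues[OF sym]
  define G where "G = {\<bar>a' - a\<bar> / (\<bar>a'\<bar> + \<bar>a\<bar>) | a a'.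
                      a \<in> eigenvalues A \<and> a' \<in> eigenvalues A \<and> a \<noteq> a'}"
  have "G \<subseteq> (\<lambda>(a, a'). \<bar>a' - a\<bar> / (\<bar>a'\<bar> + \<bar>a\<bar>)) ` (eigenvalues A \<times> eigenvalues A)"
    by (auto simp: G_def)
  then have "finite G"
    by (rule finite_subset) (simp add: finite_eigenvalues_symmetric[OF sym])
  moreover have "\<forall>g\<in>insert 0 G. g \<le> ?s"
    by (auto simp: G_def intro!: relative_gap_mono dest: ext(3))
  moreover have "?s \<in> insert 0 G"
  proof (cases "lambda_max A = lambda_min A")
    case False
    then have "lambda_min A \<noteq> lambda_max A" by simp
    then have "?s \<in> G" using ext(1,2) unfolding G_def mem_Collect_eq by metis
    then show ?thesis by simp
  qed simp
  ultimately have "Max (insert 0 G) = ?s"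
    by (intro Max_eqI) auto
  then show ?thesis by (simp add: symmetric_factor_def G_def)
qed

section \<open>One minimal residual step\<close>

text \<open>The left-hand side of the assumption is \<open>(norm (r - t *\<^sub>R (A *v r)))\<^sup>2\<close>, a quadratic
  polynomial in \<open>t\<close> whose minimizer is \<open>gmres_alpha A r\<close>. A contraction by \<open>s\<close> for one \<open>t\<close> is thus
  enough for a contraction of the GMRES(1) step. For \<open>A *v r = 0\<close> the polynomial is constant.\<close>

lemma minimal_residual_step_le:
  fixes A :: "real^'n^'n"
  assumes "t\<^sup>2 * ((A *v r) \<bullet> (A *v r)) - 2 * t * (r \<bullet> (A *v r)) + r \<bullet> r \<le> s\<^sup>2 * (r \<bullet> r)" "0 \<le> s"
  shows "norm (r - gmres_alpha A r *\<^sub>R (A *v r)) \<le> s * norm r"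
proof -
  define p where "p = r \<bullet> (A *v r)"
  define q where "q = (A *v r) \<bullet> (A *v r)"
  have expand: "(norm (r - c *\<^sub>R (A *v r)))\<^sup>2 = c\<^sup>2 * q - 2 * c * p + r \<bullet> r" for c
    unfolding power2_norm_eq_inner
    by (simp add: inner_diff_left inner_diff_right p_def q_def
        inner_commute[of "A *v r" r] power2_eq_square algebra_simps)
  have "(p / q)\<^sup>2 * q - 2 * (p / q) * p \<le> t\<^sup>2 * q - 2 * t * p"
  proof (cases "q = 0")
    case True
    then have "p = 0" by (simp add: p_def q_def)
    then show ?thesis using True by simp
  next
    case False
    then have "q > 0" by (simp add: q_def)
    have "t\<^sup>2 * q - 2 * t * p - ((p / q)\<^sup>2 * q - 2 * (p / q) * p) = q * (t - p / q)\<^sup>2"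
      using False by (simp add: field_simps power2_eq_square)
    moreover have "\<dots> \<ge> 0" using \<open>q > 0\<close> by simp
    ultimately show ?thesis by linarith
  qed
  then have "(norm (r - gmres_alpha A r *\<^sub>R (A *v r)))\<^sup>2 \<le> t\<^sup>2 * q - 2 * t * p + r \<bullet> r"
    unfolding expand by (simp add: gmres_alpha_def p_def q_def)
  also have "\<dots> \<le> (s * norm r)\<^sup>2"
    using assms(1) by (simp add: p_def q_def power_mult_distrib power2_norm_eq_inner)
  finally show ?thesis by (rule power2_le_imp_le) (simp add: assms(2))
qed

lemma gmres1_residual_contracts:
  assumes "\<And>r. norm (r - gmres_alpha A r *\<^sub>R (A *v r)) \<le> s * norm r" "1 \<le> k"
  shows "norm (gmres1_residual A b x0 k) \<le> s * norm (gmres1_residual A b x0 (k - 1))"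
proof -
  obtain j where "k = Suc j" using assms(2) by (cases k) auto
  then show ?thesis using assms(1)
    by (auto simp: gmres1_residual_def Let_def split: prod.split)
qed

text \<open>Excluding the eigenvalue \<open>0\<close> is essential: the zero matrix has factor \<open>0\<close> but leaves every
  residual unchanged.\<close>

lemma symmetric_step:
  fixes A :: "real^'n^'n"
  assumes sym: "transpose A = A" and nz: "0 \<notin> eigenvalues A"
  shows "norm (r - gmres_alpha A r *\<^sub>R (A *v r)) \<le> symmetric_factor A * norm r"
proof -
  note ext = symmetric_extreme_eigenvalues[OF sym]
  define l where "l = lambda_min A"
  define u where "u = lambda_max A"
  define p where "p = r \<bullet> (A *v r)"
  define q where "q = (A *v r) \<bullet> (A *v r)"
  have s: "symmetric_factor A = \<bar>u - l\<bar> / (\<bar>u\<bar> + \<bar>l\<bar>)"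
    unfolding l_def u_def by (rule symmetric_factor_eq[OF sym])
  have q: "q \<le> (l + u) * p - l * u * (r \<bullet> r)"
    unfolding p_def q_def l_def u_def
    using ext(4,5) symmetric_inner_matrix_vector[OF sym]
    by (intro selfadjoint_between_scalars) auto
  have "\<exists>t. t\<^sup>2 * q - 2 * t * p + r \<bullet> r \<le> (symmetric_factor A)\<^sup>2 * (r \<bullet> r)"
  proof (cases "l * u > 0")
    case True
    then have sum_nz: "l + u \<noteq> 0" by (auto simp: zero_less_mult_iff)
    \<comment> \<open>This \<open>t\<close> cancels the inner product \<open>p\<close>, as \<open>t\<^sup>2 * (l + u) = 2 * t\<close>.\<close>
    define t where "t = 2 / (l + u)"
    have "t\<^sup>2 * q \<le> t\<^sup>2 * ((l + u) * p - l * u * (r \<bullet> r))" using q by (rule mult_left_mono) simp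
    also have "\<dots> = t * (t * (l + u)) * p - t\<^sup>2 * (l * u) * (r \<bullet> r)"
      by (simp add: power2_eq_square algebra_simps)
    also have "t * (l + u) = 2" unfolding t_def using sum_nz by (rule nonzero_eq_divide_eq[THEN iffD1, OF _ refl])
    finally have "t\<^sup>2 * q - 2 * t * p + r \<bullet> r \<le> (1 - t\<^sup>2 * (l * u)) * (r \<bullet> r)"
      by (simp add: algebra_simps)
    also have "1 - t\<^sup>2 * (l * u) = ((l + u)\<^sup>2 - 4 * (l * u)) / (l + u)\<^sup>2"
      using sum_nz by (simp add: t_def power_divide diff_divide_distrib)
    also have "(l + u)\<^sup>2 - 4 * (l * u) = (u - l)\<^sup>2"
      by (simp add: power2_eq_square algebra_simps)
    also have "(u - l)\<^sup>2 / (l + u)\<^sup>2 = ((u - l) / (l + u))\<^sup>2"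
      by (simp add: power_divide)
    also have "\<dots> = (symmetric_factor A)\<^sup>2"
    proof -
      have "\<bar>l + u\<bar> = \<bar>u\<bar> + \<bar>l\<bar>" using True by (auto simp: zero_less_mult_iff)
      then show ?thesis unfolding s by (metis abs_divide power2_abs)
    qed
    finally show ?thesis by blast
  next
    case False
    have "l \<le> u" "l \<noteq> 0" using ext(1,3) nz by (auto simp: l_def u_def)
    with False have "l < 0" "0 \<le> u" by (auto simp: not_less mult_le_0_iff)
    then have "symmetric_factor A = 1" unfolding s by simp
    \<comment> \<open>Keeping the residual unchanged is an admissible choice.\<close>
    then show ?thesis by (intro exI[of _ 0]) simp
  qed
  moreover have "0 \<le> symmetric_factor A" unfolding s by simp
  ultimately show ?thesis
    unfolding p_def q_def using minimal_residual_step_le by blast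
qed

section \<open>The convergence factor of a skew-symmetric perturbation\<close>

lemma matrix_vector_mult_uminus:
  fixes M :: "real^'n^'m"
  shows "(- M) *v x = - (M *v x)"
  by (simp add: vec_eq_iff matrix_vector_mult_def sum_negf)

lemma skew_inner_matrix_vector:
  fixes M :: "real^'n^'n"
  assumes "transpose M = - M"
  shows "(M *v x) \<bullet> y = - (x \<bullet> (M *v y))"
proof -
  have "(M *v x) \<bullet> y = (transpose (transpose M) *v x) \<bullet> y" by simp
  also have "\<dots> = x \<bullet> (transpose M *v y)" by (simp only: transpose_matrix_vector dot_lmul_matrix)
  also have "\<dots> = - (x \<bullet> (M *v y))"
    by (simp add: assms matrix_vector_mult_uminus)
  finally show ?thesis .
qed

text \<open>Separating real and imaginary parts replaces a complex eigenvector of a real matrix by a pair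
  of real vectors, to which the real inner product applies.\<close>

lemma complex_eigenvector_iff_real_system:
  fixes M :: "real^'n^'n" and x y :: "real^'n"
  defines "v \<equiv> (\<chi> i. Complex (x $ i) (y $ i))"
  shows "map_matrix complex_of_real M *v v = c *s v \<longleftrightarrow>
    M *v x = Re c *\<^sub>R x - Im c *\<^sub>R y \<and> M *v y = Im c *\<^sub>R x + Re c *\<^sub>R y"
  by (auto simp: v_def vec_eq_iff matrix_vector_mult_def map_matrix_def complex_eq_iff)

text \<open>If \<open>x + \<i> y\<close> is an eigenvector for \<open>c\<close>, then \<open>x \<bullet> (M *v x) = 0 = y \<bullet> (M *v y)\<close> force
  \<open>Re c = 0\<close>, and applying \<open>M\<close> twice shows that \<open>x\<close> and \<open>y\<close>, one of which is nonzero, satisfy the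
  eigenvector equation of \<open>transpose M ** M = - (M ** M)\<close> for \<open>(cmod c)\<^sup>2\<close>. Conversely, an
  eigenvector \<open>x\<close> of \<open>transpose M ** M\<close> for \<open>m\<^sup>2\<close> with \<open>m > 0\<close> yields the complex eigenvector
  \<open>x - (\<i> / m) M x\<close> of \<open>M\<close> for \<open>\<i> m\<close>; if \<open>m = 0\<close>, then \<open>x\<close> is itself in the kernel of \<open>M\<close>.\<close>

lemma skew_eigenvalue_moduli:
  fixes M :: "real^'n^'n"
  assumes skew: "transpose M = - M"
  shows "cmod ` eigenvalues (map_matrix complex_of_real M) = sqrt ` eigenvalues (transpose M ** M)"
proof -
  note sk = skew_inner_matrix_vector[OF skew]
  have S: "(transpose M ** M) *v z = - (M *v (M *v z))" for z
    by (simp add: skew matrix_vector_mul_assoc[symmetric] matrix_vector_mult_uminus)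
  have iso: "z \<bullet> (M *v z) = 0" for z using sk[of z z] by (simp add: inner_commute)
  show ?thesis
  proof (intro equalityI subsetI)
    fix m assume "m \<in> cmod ` eigenvalues (map_matrix complex_of_real M)"
    then obtain c v where m: "m = cmod c" and "v \<noteq> 0"
      and cv: "map_matrix complex_of_real M *v v = c *s v"
      by (auto simp: eigenvalues_def)
    define x y where "x = (\<chi> i. Re (v $ i))" and "y = (\<chi> i. Im (v $ i))"
    have v: "v = (\<chi> i. Complex (x $ i) (y $ i))" by (simp add: x_def y_def vec_eq_iff)
    have Mx: "M *v x = Re c *\<^sub>R x - Im c *\<^sub>R y" and My: "M *v y = Im c *\<^sub>R x + Re c *\<^sub>R y"
      using cv unfolding v complex_eigenvector_iff_real_system by auto
    have nz: "x \<noteq> 0 \<or> y \<noteq> 0" using \<open>v \<noteq> 0\<close> by (auto simp: v vec_eq_iff complex_eq_iff)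
    have "Re c * (x \<bullet> x + y \<bullet> y) = 0"
      using iso[of x] iso[of y] unfolding Mx My
      by (simp add: inner_diff_right inner_add_right inner_commute[of y x] algebra_simps)
    moreover have "x \<bullet> x + y \<bullet> y > 0"
      using nz by (metis add_nonneg_eq_0_iff inner_eq_zero_iff inner_ge_zero less_eq_real_def add_nonneg_nonneg)
    ultimately have Re: "Re c = 0" by simp
    have "(transpose M ** M) *v x = (Im c)\<^sup>2 *\<^sub>R x" "(transpose M ** M) *v y = (Im c)\<^sup>2 *\<^sub>R y"
      by (simp_all add: S Mx My Re matrix_vector_mult_scaleR power2_eq_square
          linear_neg[OF matrix_vector_mul_linear])
    then have "(Im c)\<^sup>2 \<in> eigenvalues (transpose M ** M)"
      using nz by (auto simp: mem_eigenvalues_real_iff)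
    moreover have "m = sqrt ((Im c)\<^sup>2)" by (simp add: m cmod_def Re)
    ultimately show "m \<in> sqrt ` eigenvalues (transpose M ** M)" by blast
  next
    fix m assume "m \<in> sqrt ` eigenvalues (transpose M ** M)"
    then obtain \<nu> x where m: "m = sqrt \<nu>" and x: "x \<noteq> 0" "(transpose M ** M) *v x = \<nu> *\<^sub>R x"
      by (auto simp: mem_eigenvalues_real_iff)
    have "\<nu> * (x \<bullet> x) = x \<bullet> ((transpose M ** M) *v x)" by (simp add: x(2))
    also have "\<dots> = (M *v x) \<bullet> (M *v x)" using sk[of x "M *v x"] by (simp add: S)
    finally have energy: "\<nu> * (x \<bullet> x) = (M *v x) \<bullet> (M *v x)" .
    have nonneg: "\<nu> \<ge> 0"
      using x(1) by (metis energy inner_ge_zero inner_gt_zero_iff zero_le_mult_iff not_less)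
    \<comment> \<open>For \<open>m = 0\<close> this is the zero vector, so that the real eigenvector \<open>x\<close> itself is used.\<close>
    define y where "y = (- 1 / m) *\<^sub>R (M *v x)"
    have "M *v x = - m *\<^sub>R y"
      using energy by (cases "m = 0") (auto simp: y_def m)
    moreover have "M *v y = m *\<^sub>R x"
    proof -
      have "M *v (M *v x) = - (\<nu> *\<^sub>R x)" using x(2) by (simp add: S minus_equation_iff)
      then have "M *v y = (\<nu> / m) *\<^sub>R x"
        unfolding y_def matrix_vector_mult_scaleR by simp
      also have "\<nu> / m = m" using nonneg by (simp add: m real_div_sqrt)
      finally show ?thesis .
    qed
    ultimately have "map_matrix complex_of_real M *v (\<chi> i. Complex (x $ i) (y $ i)) =
        (\<i> * complex_of_real m) *s (\<chi> i. Complex (x $ i) (y $ i))"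
      unfolding complex_eigenvector_iff_real_system by simp
    moreover have "(\<chi> i. Complex (x $ i) (y $ i)) \<noteq> 0"
      using x(1) by (auto simp: vec_eq_iff complex_eq_iff)
    ultimately have "\<i> * complex_of_real m \<in> eigenvalues (map_matrix complex_of_real M)"
      unfolding eigenvalues_def by blast
    moreover have "m = cmod (\<i> * complex_of_real m)" using nonneg by (simp add: m norm_mult)
    ultimately show "m \<in> cmod ` eigenvalues (map_matrix complex_of_real M)" by blast
  qed
qed

text \<open>The square of the largest modulus is the largest eigenvalue of \<open>transpose M ** M\<close>, whose
  quadratic form is \<open>(M *v x) \<bullet> (M *v x)\<close>.\<close>

lemma skew_max_eigenvalue_modulus_bound:
  fixes M :: "real^'n^'n"
  assumes skew: "transpose M = - M"
  shows "0 \<le> max_eigenvalue_modulus M"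
    and "(M *v x) \<bullet> (M *v x) \<le> (max_eigenvalue_modulus M)\<^sup>2 * (x \<bullet> x)"
proof -
  have sym: "transpose (transpose M ** M) = transpose M ** M"
    by (simp add: matrix_transpose_mul)
  note ext = symmetric_extreme_eigenvalues[OF sym]
  define u where "u = lambda_max (transpose M ** M)"
  have fin: "finite (cmod ` eigenvalues (map_matrix complex_of_real M))"
    unfolding skew_eigenvalue_moduli[OF skew] by (simp add: finite_eigenvalues_symmetric[OF sym])
  have mem: "sqrt u \<in> cmod ` eigenvalues (map_matrix complex_of_real M)"
    unfolding skew_eigenvalue_moduli[OF skew] u_def using ext(2) by blast
  have le: "sqrt u \<le> max_eigenvalue_modulus M"
    unfolding max_eigenvalue_modulus_def using fin mem by simp
  moreover have pos: "0 \<le> sqrt u" using mem by (metis imageE norm_ge_zero)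
  ultimately show nonneg: "0 \<le> max_eigenvalue_modulus M" by (rule order_trans[rotated])
  have "u = (sqrt u)\<^sup>2" using pos by simp
  also have "\<dots> \<le> (max_eigenvalue_modulus M)\<^sup>2" using le pos by (rule power_mono)
  finally have u: "u \<le> (max_eigenvalue_modulus M)\<^sup>2" .
  have "(M *v x) \<bullet> (M *v x) = x \<bullet> ((transpose M ** M) *v x)"
    by (metis dot_lmul_matrix matrix_vector_mul_assoc transpose_matrix_vector transpose_transpose)
  also have "\<dots> \<le> u * (x \<bullet> x)" unfolding u_def by (rule ext(5))
  also have "\<dots> \<le> (max_eigenvalue_modulus M)\<^sup>2 * (x \<bullet> x)" using u by (rule mult_right_mono) simp
  finally show "(M *v x) \<bullet> (M *v x) \<le> (max_eigenvalue_modulus M)\<^sup>2 * (x \<bullet> x)" .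
qed

lemma skew_step:
  fixes A :: "real^'n^'n"
  assumes skew: "transpose (mat 1 - A) = - (mat 1 - A)"
  shows "norm (r - gmres_alpha A r *\<^sub>R (A *v r)) \<le> skew_factor (mat 1 - A) * norm r"
proof (rule minimal_residual_step_le)
  define M where "M = mat 1 - A"
  define m where "m = max_eigenvalue_modulus M"
  \<comment> \<open>The minimizer of \<open>t\<^sup>2 * (1 + m\<^sup>2) - 2 * t + 1\<close>, the factor that results once \<open>M *v r\<close>
    has been bounded by \<open>m\<close>.\<close>
  define t where "t = 1 / (1 + m\<^sup>2)"
  have sk: "transpose M = - M" using skew by (simp add: M_def)
  have pos: "1 + m\<^sup>2 > 0" by (simp add: add_pos_nonneg)
  have Ar: "A *v r = r - M *v r" by (simp add: M_def matrix_vector_mult_diff_rdistrib)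
  have iso: "r \<bullet> (M *v r) = 0"
    using skew_inner_matrix_vector[OF sk, of r r] by (simp add: inner_commute)
  have "t\<^sup>2 * ((A *v r) \<bullet> (A *v r)) - 2 * t * (r \<bullet> (A *v r)) + r \<bullet> r =
      t\<^sup>2 * (r \<bullet> r + (M *v r) \<bullet> (M *v r)) - 2 * t * (r \<bullet> r) + r \<bullet> r"
    by (simp add: Ar inner_diff_left inner_diff_right iso inner_commute[of "M *v r" r])
  also have "\<dots> \<le> t\<^sup>2 * (r \<bullet> r + m\<^sup>2 * (r \<bullet> r)) - 2 * t * (r \<bullet> r) + r \<bullet> r"
    using skew_max_eigenvalue_modulus_bound(2)[OF sk, of r]
    by (simp add: m_def mult_left_mono)
  also have "\<dots> = (t\<^sup>2 * (1 + m\<^sup>2) - 2 * t + 1) * (r \<bullet> r)" by (simp add: algebra_simps)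
  also have "t\<^sup>2 * (1 + m\<^sup>2) - 2 * t + 1 = m\<^sup>2 / (1 + m\<^sup>2)"
  proof -
    have "t * (1 + m\<^sup>2) = 1" using pos by (simp add: t_def)
    then have "t\<^sup>2 * (1 + m\<^sup>2) = t" by (simp add: power2_eq_square mult.assoc)
    moreover have "m\<^sup>2 / (1 + m\<^sup>2) = 1 - t"
      using pos by (simp add: t_def field_simps)
    ultimately show ?thesis by simp
  qed
  also have "\<dots> = (skew_factor M)\<^sup>2"
    using pos by (simp add: skew_factor_def m_def power_divide)
  finally show "t\<^sup>2 * ((A *v r) \<bullet> (A *v r)) - 2 * t * (r \<bullet> (A *v r)) + r \<bullet> r
      \<le> (skew_factor (mat 1 - A))\<^sup>2 * (r \<bullet> r)" unfolding M_def .
  show "0 \<le> skew_factor (mat 1 - A)"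
    using skew_max_eigenvalue_modulus_bound(1)[OF skew] by (simp add: skew_factor_def)
qed

lemma skew_factor_less_1: "skew_factor M < 1"
proof -
  have "max_eigenvalue_modulus M < sqrt (1 + (max_eigenvalue_modulus M)\<^sup>2)"
    by (rule real_less_rsqrt) simp
  then show ?thesis by (simp add: skew_factor_def divide_less_eq add_pos_nonneg)
qed

lemma skew_factor_pos:
  fixes M :: "real^'n^'n"
  assumes skew: "transpose M = - M" and "M \<noteq> 0"
  shows "0 < skew_factor M"
proof -
  have "max_eigenvalue_modulus M \<noteq> 0"
  proof
    assume "max_eigenvalue_modulus M = 0"
    then have "M *v x = 0" for x
      using skew_max_eigenvalue_modulus_bound(2)[OF skew, of x]
      by (metis inner_eq_zero_iff inner_ge_zero mult_zero_left order_antisym power_zero_numeral)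
    then have "M = 0" by (simp add: matrix_eq)
    with \<open>M \<noteq> 0\<close> show False ..
  qed
  then show ?thesis
    using skew_max_eigenvalue_modulus_bound(1)[OF skew]
    by (simp add: skew_factor_def add_pos_nonneg)
qed

section \<open>Convergence of GMRES(1)\<close>

lemma definite_extreme_eigenvalues_same_sign:
  fixes A :: "real^'n^'n"
  assumes "transpose A = A" "definite A"
  shows "0 < lambda_min A \<or> lambda_max A < 0"
proof -
  note ext = symmetric_extreme_eigenvalues[OF assms(1)]
  have quad: "\<exists>v. v \<noteq> 0 \<and> v \<bullet> (A *v v) = c * (v \<bullet> v)" if "c \<in> eigenvalues A" for c
    using that unfolding mem_eigenvalues_real_iff by (metis inner_scaleR_right)
  from assms(2) show ?thesis unfolding definite_def
  proof
    assume "positive_definite A"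
    then show ?thesis using quad[OF ext(1)]
      by (metis positive_definite_def inner_gt_zero_iff zero_less_mult_pos2)
  next
    assume "negative_definite A"
    then show ?thesis using quad[OF ext(2)]
      by (metis negative_definite_def inner_ge_zero mult_nonneg_nonneg not_less)
  qed
qed

theorem theorem3p6:
  fixes A :: "real^'n^'n" and b x0 :: "real^'n"
  assumes "invertible A"
  shows
    "(transpose A = A \<longrightarrow>
        (\<forall>k\<ge>1. norm (gmres1_residual A b x0 k)
                \<le> symmetric_factor A * norm (gmres1_residual A b x0 (k - 1))) \<and>
        (definite A \<longrightarrow>
           symmetric_factor A
             = \<bar>(lambda_max A - lambda_min A) / (lambda_max A + lambda_min A)\<bar> \<and>
           symmetric_factor A < 1 \<and>
           (card (eigenvalues A) \<ge> 2 \<longrightarrow>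
              q_linearly_converges (gmres1_residual A b x0) 0 (symmetric_factor A))) \<and>
        (indefinite A \<longrightarrow> symmetric_factor A = 1)) \<and>
     (transpose (mat 1 - A) = - (mat 1 - A) \<and> even CARD('n) \<longrightarrow>
        (\<forall>k\<ge>1. norm (gmres1_residual A b x0 k)
                \<le> skew_factor (mat 1 - A) * norm (gmres1_residual A b x0 (k - 1))) \<and>
        skew_factor (mat 1 - A) < 1 \<and>
        (mat 1 - A \<noteq> 0 \<longrightarrow>
           q_linearly_converges (gmres1_residual A b x0) 0 (skew_factor (mat 1 - A))))"

proof (intro conjI impI)
  have nz: "0 \<notin> eigenvalues A"
    using assms by (auto simp: mem_eigenvalues_real_iff invertible_left_inverse
        matrix_left_invertible_ker)
  {
    assume sym: "transpose A = A"
    note ext = symmetric_extreme_eigenvalues[OF sym] and s = symmetric_factor_eq[OF sym]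
    show contr: "\<forall>k\<ge>1. norm (gmres1_residual A b x0 k)
        \<le> symmetric_factor A * norm (gmres1_residual A b x0 (k - 1))"
      using gmres1_residual_contracts[OF symmetric_step[OF sym nz]] by blast
    have le: "lambda_min A \<le> lambda_max A" using ext(1,3) by blast
    {
      assume "definite A"
      note sign = definite_extreme_eigenvalues_same_sign[OF sym this]
      show "symmetric_factor A = \<bar>(lambda_max A - lambda_min A) / (lambda_max A + lambda_min A)\<bar>"
        using sign le unfolding s by (auto simp: abs_divide)
      show lt: "symmetric_factor A < 1"
        using sign le unfolding s by (auto simp: divide_less_eq)
      assume card: "2 \<le> card (eigenvalues A)"
      have "lambda_min A \<noteq> lambda_max A"
      proof
        assume eq: "lambda_min A = lambda_max A"
        have "eigenvalues A \<subseteq> {lambda_max A}" using ext(3) eq by force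
        then have "card (eigenvalues A) \<le> card {lambda_max A}" by (intro card_mono) auto
        with card show False by simp
      qed
      then have "0 < symmetric_factor A" unfolding s using sign by (auto simp: divide_pos_pos)
      then show "q_linearly_converges (gmres1_residual A b x0) 0 (symmetric_factor A)"
        using lt contr by (simp add: q_linearly_converges_def)
    }
    assume "indefinite A"
    then have "lambda_min A < 0" "0 < lambda_max A"
      unfolding indefinite_def using ext(3) by force+
    then show "symmetric_factor A = 1" unfolding s by simp
  }
  assume "transpose (mat 1 - A) = - (mat 1 - A) \<and> even CARD('n)"
  then have skew: "transpose (mat 1 - A) = - (mat 1 - A)" ..
  show contr: "\<forall>k\<ge>1. norm (gmres1_residual A b x0 k)
      \<le> skew_factor (mat 1 - A) * norm (gmres1_residual A b x0 (k - 1))"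
    using gmres1_residual_contracts[OF skew_step[OF skew]] by blast
  show "skew_factor (mat 1 - A) < 1" by (rule skew_factor_less_1)
  assume "mat 1 - A \<noteq> 0"
  then show "q_linearly_converges (gmres1_residual A b x0) 0 (skew_factor (mat 1 - A))"
    using contr skew_factor_pos[OF skew] skew_factor_less_1
    by (simp add: q_linearly_converges_def)
qed

end
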